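(* Let $k\geq 1$ be an integer, let $\sigma$ be a permutation of the set $\{1,2,\dots,k\}$, and let $m_1,\dots,m_k\in\mathbb{N}$ with $m_i\geq 2$ for all $i$. Define $f:\mathbb{T}^k\to\mathbb{T}^k$ by $$f(z_1,z_2,\dots,z_k)=\left(z_{\sigma^{-1}(1)}^{m_1},\,z_{\sigma^{-1}(2)}^{m_2},\,\dots,\,z_{\sigma^{-1}(k)}^{m_k}\right).$$ If $\gcd\{m_j : j\in\widetilde{\sigma}(i)\}>1$ for all $i\in\{1,\dots,k\}$, or if $\sigma$ is the identity permutation, then $f$ is topologically mixing.
   Context: $\mathbb{T}=\{z\in\mathbb{C}:|z|=1\}$ is the circle group, with complex multiplication and the topology induced by the arclength metric; $\mathbb{T}^k$ is the product of $k$ copies of $\mathbb{T}$ with the product topology and coordinatewise multiplication. For $i\in\{1,\dots,k\}$, $\widetilde{\sigma}(i)$ denotes the orbit of $i$ under $\sigma$. A continuous map $f:X\to X$ on a topological space $X$ is topologically mixing (or just mixing) if for any two non-empty open sets $U,V\subseteq X$ there exists a natural number $N$ such that $f^n(U)\cap V\neq\emptyset$ for all $n>N$, where $f^n$ denotes the $n$-fold iterate of $f$. *)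

theory Defs
  imports "HOL-Analysis.Analysis" "HOL-Combinatorics.Orbits"
begin

definition topologically_mixing :: "'a topology \<Rightarrow> ('a \<Rightarrow> 'a) \<Rightarrow> bool" where
  "topologically_mixing X f \<longleftrightarrow>
     continuous_map X X f \<and>
     (\<forall>U V. openin X U \<and> U \<noteq> {} \<and> openin X V \<and> V \<noteq> {} \<longrightarrow>
        (\<exists>N::nat. \<forall>n>N. (f ^^ n) ` U \<inter> V \<noteq> {}))"

(* For z, w on the unit circle, the length of the shorter arc between them:
   Arg takes values in (-pi, pi], and w = z * cis (Arg (w / z)). *)
definition arc_dist :: "complex \<Rightarrow> complex \<Rightarrow> real" where
  "arc_dist z w = \<bar>Arg (w / z)\<bar>"

definition circle_topology :: "complex topology" where
  "circle_topology = Metric_space.mtopology (sphere 0 1) arc_dist"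

(* Points of the k-torus are the functions z, extensional on {1..k},
   with z i on the unit circle for each i in {1..k}. *)
definition torus_topology :: "nat \<Rightarrow> (nat \<Rightarrow> complex) topology" where
  "torus_topology k = product_topology (\<lambda>_. circle_topology) {1..k}"

definition torus_map ::
  "nat \<Rightarrow> (nat \<Rightarrow> nat) \<Rightarrow> (nat \<Rightarrow> nat) \<Rightarrow> (nat \<Rightarrow> complex) \<Rightarrow> (nat \<Rightarrow> complex)" where
  "torus_map k \<sigma> m z = (\<lambda>i\<in>{1..k}. z (inv \<sigma> i) ^ m i)"

lemma abs_Arg_cis_le: "\<bar>Arg (cis t)\<bar> \<le> \<bar>t\<bar>"
proof (cases "t \<in> {-pi<..pi}")
  case True
  then show ?thesis by (simp add: Arg_cis)
next
  case False
  then have "pi \<le> \<bar>t\<bar>" by auto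
  moreover have "\<bar>Arg (cis t)\<bar> \<le> pi"
    using Arg_bounded[of "cis t"] by auto
  ultimately show ?thesis by linarith
qed

lemma cis_Arg_circle: "norm z = 1 \<Longrightarrow> cis (Arg z) = z"
  by (metis cis_Arg norm_zero sgn_eq div_by_1 of_real_1 zero_neq_one)

lemma Metric_space_arc_dist: "Metric_space (sphere 0 1) arc_dist"
proof
  fix x y :: complex
  show "0 \<le> arc_dist x y" by (simp add: arc_dist_def)
  show "arc_dist x y = arc_dist y x"
  proof (cases "x = 0 \<or> y = 0")
    case False
    have "Arg (inverse (y / x)) = (if Arg (y / x) = pi then pi else - Arg (y / x))"
      using False Arg_inverse[of "y / x"] Arg_eq_pi_iff[of "y / x"] Arg_eq_0_pi[of "y / x"]
      by (auto simp: Arg_eq_0)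
    then show ?thesis by (auto simp: arc_dist_def)
  qed (auto simp: arc_dist_def)
next
  fix x y :: complex
  assume xy: "x \<in> sphere 0 1" "y \<in> sphere 0 1"
  then have "cis (Arg (y / x)) = y / x"
    by (intro cis_Arg_circle) (simp add: norm_divide)
  then show "arc_dist x y = 0 \<longleftrightarrow> x = y"
    using xy by (auto simp: arc_dist_def)
next
  fix x y z :: complex
  assume xyz: "x \<in> sphere 0 1" "y \<in> sphere 0 1" "z \<in> sphere 0 1"
  have "cis (Arg (y / x)) = y / x" "cis (Arg (z / y)) = z / y"
    using xyz by (auto intro!: cis_Arg_circle simp: norm_divide)
  then have "cis (Arg (y / x) + Arg (z / y)) = (y / x) * (z / y)"
    by (metis cis_mult)
  also have "\<dots> = z / x" using xyz by auto
  finally have "\<bar>Arg (z / x)\<bar> \<le> \<bar>Arg (y / x) + Arg (z / y)\<bar>"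
    by (metis abs_Arg_cis_le)
  then show "arc_dist x z \<le> arc_dist x y + arc_dist y z"
    by (simp add: arc_dist_def)
qed

lemma circle_topology_eq: "circle_topology = top_of_set (sphere 0 1)"
proof -
  interpret Metric_space "sphere 0 1" arc_dist by (rule Metric_space_arc_dist)
  have dist_quot: "dist x y = norm (y / x - 1)" if "norm x = 1" for x y :: complex
  proof -
    have "norm (y / x - 1) = norm ((y - x) / x)" using that by (auto simp: diff_divide_distrib)
    then show ?thesis using that by (simp add: norm_divide dist_norm norm_minus_commute)
  qed
  have le: "dist x y \<le> arc_dist x y" if "norm x = 1" "norm y = 1" for x y :: complex
  proof -
    define t where "t = Arg (y / x)"
    have "cis t = y / x"
      unfolding t_def using that by (intro cis_Arg_circle) (simp add: norm_divide)
    then have "dist x y = norm (exp (\<i> * of_real t) - 1)"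
      using that dist_quot by (simp add: cis_conv_exp)
    also have "\<dots> \<le> \<bar>t\<bar>"
      unfolding dist_exp_i_1 using abs_sin_x_le_abs_x[of "t / 2"] by simp
    finally show ?thesis by (simp add: arc_dist_def t_def)
  qed
  have small: "\<exists>d>0. \<forall>x y. norm x = 1 \<and> norm y = 1 \<and> dist x y < d \<longrightarrow> arc_dist x y < r"
    if "r > 0" for r
  proof -
    have "isCont Arg 1" by (rule continuous_at_Arg) auto
    then obtain d where "d > 0" and d: "\<And>u. dist u 1 < d \<Longrightarrow> dist (Arg u) (Arg 1) < r"
      using \<open>r > 0\<close> unfolding continuous_at_eps_delta by blast
    have "arc_dist x y < r" if "norm x = 1" "norm y = 1" "dist x y < d" for x y
      using d[of "y / x"] that dist_quot[of x y] by (simp add: arc_dist_def dist_norm)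
    with \<open>d > 0\<close> show ?thesis by blast
  qed
  have "openin mtopology U \<longleftrightarrow> openin (top_of_set (sphere 0 1)) U" for U
  proof
    assume U: "openin mtopology U"
    then have sub: "U \<subseteq> sphere 0 1" by (simp add: openin_mtopology)
    have "\<exists>e>0. \<forall>x'\<in>sphere 0 1. dist x' x < e \<longrightarrow> x' \<in> U" if "x \<in> U" for x
    proof -
      obtain r where r: "r > 0" "mball x r \<subseteq> U" using U \<open>x \<in> U\<close> unfolding openin_mtopology by blast
      obtain d where "d > 0"
        and d: "\<And>x y. norm x = 1 \<Longrightarrow> norm y = 1 \<Longrightarrow> dist x y < d \<Longrightarrow> arc_dist x y < r"
        using small[OF r(1)] by blast
      have "x' \<in> U" if "x' \<in> sphere 0 1" "dist x' x < d" for x'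
      proof -
        have "x \<in> sphere 0 1" using sub \<open>x \<in> U\<close> by blast
        then have "x' \<in> mball x r"
          using that d[of x x'] by (simp add: in_mball dist_commute)
        then show ?thesis using r(2) by blast
      qed
      with \<open>d > 0\<close> show ?thesis by blast
    qed
    with sub show "openin (top_of_set (sphere 0 1)) U"
      by (auto simp: openin_euclidean_subtopology_iff)
  next
    assume U: "openin (top_of_set (sphere 0 1)) U"
    then have sub: "U \<subseteq> sphere 0 1" by (simp add: openin_euclidean_subtopology_iff)
    have "\<exists>r>0. mball x r \<subseteq> U" if "x \<in> U" for x
    proof -
      obtain e where e: "e > 0" "\<And>x'. x' \<in> sphere 0 1 \<Longrightarrow> dist x' x < e \<Longrightarrow> x' \<in> U"
        using U \<open>x \<in> U\<close> unfolding openin_euclidean_subtopology_iff by metis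
      have "y \<in> U" if "y \<in> mball x e" for y
      proof (rule e(2))
        show "y \<in> sphere 0 1" using that by (simp add: in_mball)
        show "dist y x < e" using that le[of x y] by (simp add: in_mball dist_commute)
      qed
      with e(1) show ?thesis by blast
    qed
    with sub show "openin mtopology U" by (auto simp: openin_mtopology)
  qed
  then show ?thesis unfolding circle_topology_def topology_eq by blast
qed

lemma topspace_torus_topology:
  "topspace (torus_topology k) = {1..k} \<rightarrow>\<^sub>E sphere 0 1"
  by (simp add: torus_topology_def circle_topology_eq)

end

theory Submission
  imports Defs
begin

text \<open>
  The \<open>n\<close>-th iterate sends \<open>z\<close> to the point with \<open>i\<close>-th coordinate
  \<open>z\<^sub>j\<^sup>M\<close>, where \<open>j = \<sigma>\<^sup>-\<^sup>n(i)\<close> and \<open>M \<ge> 2\<^sup>n\<close>.  Distinct coordinates of the image depend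
  on distinct coordinates of \<open>z\<close>, and a large power maps any given arc onto the whole circle.
  Hence a box of nonempty open sets is eventually mapped onto the whole torus.
\<close>

text \<open>\<open>B\<close> contains all points of the circle within some distance \<open>e\<close>
  of a point \<open>u\<close>. The \<open>M\<close>-th power multiplies angles measured from
  \<open>u\<close> by \<open>M\<close>, so angles of size at most \<open>pi / M\<close> already
  reach every \<open>w\<close>; it suffices that \<open>pi / M < e\<close>.\<close>

lemma power_map_expands_circle:
  assumes "openin (top_of_set (sphere (0::complex) 1)) B" "B \<noteq> {}"
  shows "\<exists>K. \<forall>M\<ge>K. \<forall>w\<in>sphere 0 1. \<exists>z\<in>B. z ^ M = w"
proof -
  obtain u where "u \<in> B" using assms(2) by blast
  then have u: "norm u = 1" using openin_imp_subset[OF assms(1)] by auto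
  obtain e where "e > 0" and e: "\<And>z. z \<in> sphere 0 1 \<Longrightarrow> dist z u < e \<Longrightarrow> z \<in> B"
    using assms(1) \<open>u \<in> B\<close> unfolding openin_euclidean_subtopology_iff by metis
  obtain K :: nat where K: "pi / e < real K" using reals_Archimedean2 by blast
  have "\<exists>z\<in>B. z ^ M = w" if "M \<ge> K" and w: "w \<in> sphere 0 1" for M w
  proof -
    define t where "t = Arg (w / u ^ M)"
    have M: "pi / e < real M" using K \<open>M \<ge> K\<close> by linarith
    then have "M > 0" using divide_pos_pos[OF pi_gt_zero \<open>e > 0\<close>] by linarith
    \<comment> \<open>Rotating \<open>u\<close> by one \<open>M\<close>-th of the angle
      \<open>t\<close> from \<open>u ^ M\<close> to \<open>w\<close> gives an \<open>M\<close>-th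
      root of \<open>w\<close> close to \<open>u\<close>.\<close>
    define z where "z = u * cis (t / M)"
    have "u ^ M \<noteq> 0" using u by auto
    have "cis t = w / u ^ M"
      unfolding t_def using w u by (intro cis_Arg_circle) (simp add: norm_divide norm_power)
    moreover have "cis (t / M) ^ M = cis t"
      using \<open>M > 0\<close> by (simp add: Complex.DeMoivre)
    ultimately have "z ^ M = w"
      using \<open>M > 0\<close> \<open>u ^ M \<noteq> 0\<close> by (simp add: z_def power_mult_distrib)
    moreover have "z \<in> B"
    proof (rule e)
      show "z \<in> sphere 0 1" using u by (simp add: z_def norm_mult)
      have "dist z u = norm (u * (cis (t / M) - 1))"
        by (simp add: z_def dist_norm algebra_simps)
      also have "\<dots> = norm (exp (\<i> * of_real (t / M)) - 1)"
        using u by (simp only: norm_mult cis_conv_exp mult_1)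
      \<comment> \<open>The chord \<open>2 * \<bar>sin (s / 2)\<bar>\<close> is at most the arc
        \<open>\<bar>s\<bar>\<close>, here with \<open>s = t / M\<close>.\<close>
      also have "\<dots> \<le> \<bar>t / M\<bar>"
        unfolding dist_exp_i_1 using abs_sin_x_le_abs_x[of "t / M / 2"] by simp
      also have "\<dots> \<le> pi / M"
        using Arg_bounded[of "w / u ^ M"] by (auto simp: t_def intro!: divide_right_mono)
      also have "\<dots> < e" using M \<open>e > 0\<close> \<open>M > 0\<close> by (simp add: field_simps)
      finally show "dist z u < e" .
    qed
    ultimately show ?thesis by blast
  qed
  then show ?thesis by blast
qed

text \<open>Each application moves the index back by \<open>inv \<sigma>\<close> and contributes the
  exponent found there, so exponents multiply along the backward orbit of \<open>i\<close>.
  Extensionality of \<open>z\<close> makes the case \<open>n = 0\<close> an equality of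
  functions.\<close>

lemma torus_map_funpow:
  assumes "\<sigma> permutes {1..k}" "z \<in> extensional {1..k}"
  shows "(torus_map k \<sigma> m ^^ n) z =
    (\<lambda>i\<in>{1..k}. z ((inv \<sigma> ^^ n) i) ^ (\<Prod>j<n. m ((inv \<sigma> ^^ j) i)))"
proof (induction n)
  case 0
  show ?case using assms(2) by (simp add: extensional_restrict)
next
  case (Suc n)
  show ?case
  proof
    fix i
    show "(torus_map k \<sigma> m ^^ Suc n) z i =
      (\<lambda>i\<in>{1..k}. z ((inv \<sigma> ^^ Suc n) i) ^ (\<Prod>j<Suc n. m ((inv \<sigma> ^^ j) i))) i"
    proof (cases "i \<in> {1..k}")
      case True
      then have inv: "inv \<sigma> i \<in> {1..k}"
        using permutes_in_image[OF permutes_inv[OF assms(1)]] by blast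
      \<comment> \<open>The outermost application is peeled off, leaving the induction hypothesis at
        \<open>inv \<sigma> i\<close>; its product is thus shifted by one, and \<open>m i\<close>
        supplies the missing factor \<open>j = 0\<close>.\<close>
      have "(torus_map k \<sigma> m ^^ Suc n) z i = (torus_map k \<sigma> m ^^ n) z (inv \<sigma> i) ^ m i"
        using True by (simp add: torus_map_def)
      also have "\<dots> = z ((inv \<sigma> ^^ n) (inv \<sigma> i)) ^
          (m i * (\<Prod>j<n. m ((inv \<sigma> ^^ j) (inv \<sigma> i))))"
        unfolding Suc using inv by (simp add: power_mult[symmetric] mult.commute)
      also have "\<dots> = z ((inv \<sigma> ^^ Suc n) i) ^ (\<Prod>j<Suc n. m ((inv \<sigma> ^^ j) i))"
        unfolding prod.lessThan_Suc_shift funpow_Suc_right by simp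
      finally show ?thesis using True by simp
    next
      \<comment> \<open>Outside the index set both restrictions return
        \<open>undefined\<close>.\<close>
      case False
      then show ?thesis by (simp only: funpow.simps comp_apply torus_map_def restrict_def if_False)
    qed
  qed
qed

lemma continuous_map_torus_map:
  assumes "\<sigma> permutes {1..k}"
  shows "continuous_map (torus_topology k) (torus_topology k) (torus_map k \<sigma> m)"
proof -
  have "continuous_map (torus_topology k) circle_topology (\<lambda>z. torus_map k \<sigma> m z i)"
    if i: "i \<in> {1..k}" for i
  proof -
    have "inv \<sigma> i \<in> {1..k}"
      using i permutes_in_image[OF permutes_inv[OF assms]] by blast
    then have "continuous_map (torus_topology k) circle_topology (\<lambda>z. z (inv \<sigma> i))"
      unfolding torus_topology_def by (rule continuous_map_product_projection)
    moreover have "continuous_map circle_topology circle_topology (\<lambda>w. w ^ m i)"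
      unfolding circle_topology_eq
      by (auto simp: norm_power intro!: continuous_intros)
    ultimately show ?thesis
      using continuous_map_compose[of _ _ "\<lambda>z. z (inv \<sigma> i)" _ "\<lambda>w. w ^ m i"] i
      by (simp add: torus_map_def comp_def)
  qed
  then show ?thesis
    unfolding torus_topology_def[of k] continuous_map_componentwise
    by (auto simp: torus_map_def)
qed

theorem proposition2:
  fixes k :: nat and \<sigma> :: "nat \<Rightarrow> nat" and m :: "nat \<Rightarrow> nat"
  assumes "k \<ge> 1"
    and "\<sigma> permutes {1..k}"
    and "\<And>i. i \<in> {1..k} \<Longrightarrow> m i \<ge> 2"
    and "(\<forall>i\<in>{1..k}. Gcd (m ` orbit \<sigma> i) > 1) \<or> \<sigma> = id"
  shows "topologically_mixing (torus_topology k) (torus_map k \<sigma> m)"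
  unfolding topologically_mixing_def
proof (intro conjI allI impI)
  show "continuous_map (torus_topology k) (torus_topology k) (torus_map k \<sigma> m)"
    using assms(2) by (rule continuous_map_torus_map)
next
  fix U V
  assume UV: "openin (torus_topology k) U \<and> U \<noteq> {} \<and> openin (torus_topology k) V \<and> V \<noteq> {}"
  then obtain u v where "u \<in> U" "v \<in> V" by blast
  have v: "v \<in> {1..k} \<rightarrow>\<^sub>E sphere 0 1"
    using UV \<open>v \<in> V\<close> openin_subset topspace_torus_topology by blast
  obtain B where B: "\<And>i. i \<in> {1..k} \<Longrightarrow> openin circle_topology (B i)"
    "u \<in> Pi\<^sub>E {1..k} B" "Pi\<^sub>E {1..k} B \<subseteq> U"
    using UV \<open>u \<in> U\<close> unfolding torus_topology_def openin_product_topology_alt by metis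
  have "\<exists>K. \<forall>M\<ge>K. \<forall>w\<in>sphere 0 1. \<exists>z\<in>B i. z ^ M = w" if "i \<in> {1..k}" for i
    using that B(1,2) by (intro power_map_expands_circle) (auto simp: circle_topology_eq)
  then obtain K where
    K: "\<And>i M w. i \<in> {1..k} \<Longrightarrow> M \<ge> K i \<Longrightarrow> w \<in> sphere 0 1 \<Longrightarrow> \<exists>z\<in>B i. z ^ M = w"
    by metis
  \<comment> \<open>A sum of naturals bounds each summand, so \<open>N\<close> is a common threshold
    for all coordinates.\<close>
  define N where "N = (\<Sum>i\<in>{1..k}. K i)"
  have "v \<in> (torus_map k \<sigma> m ^^ n) ` U" if "n > N" for n
  proof -
    define M where "M i = (\<Prod>j<n. m ((inv \<sigma> ^^ j) i))" for i
    have bij: "bij \<sigma>" using assms(2) by (rule permutes_bij)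
    have in_inv: "(inv \<sigma> ^^ j) i \<in> {1..k}" if "i \<in> {1..k}" for i j
      using that permutes_in_image[OF permutes_inv[OF assms(2)]] by (induction j) auto
    have in_fwd: "(\<sigma> ^^ j) i \<in> {1..k}" if "i \<in> {1..k}" for i j
      using that permutes_in_image[OF assms(2)] by (induction j) auto
    \<comment> \<open>Two independent indices: the threshold \<open>K\<close> belongs to the source
      coordinate, the exponent \<open>M\<close> to the target coordinate.\<close>
    have M_ge: "K i \<le> M l" if "i \<in> {1..k}" "l \<in> {1..k}" for i l
    proof -
      have "K i \<le> N" unfolding N_def using that(1) by (intro member_le_sum) auto
      also have "N < 2 ^ n" using \<open>n > N\<close> less_exp[of n] by linarith
      also have "(2::nat) ^ n = (\<Prod>j<n. 2)" by simp
      also have "\<dots> \<le> M l"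
        unfolding M_def using assms(3) in_inv[OF that(2)] by (intro prod_mono) auto
      finally show ?thesis by simp
    qed
    \<comment> \<open>Coordinate \<open>i\<close> of a point affects only coordinate
      \<open>(\<sigma> ^^ n) i\<close> of its image, so the equations for hitting \<open>v\<close>
      decouple and are solved one coordinate at a time.\<close>
    have "\<exists>x\<in>B i. x ^ M ((\<sigma> ^^ n) i) = v ((\<sigma> ^^ n) i)" if "i \<in> {1..k}" for i
      using that in_fwd[OF that] v by (intro K M_ge) (auto intro: PiE_mem)
    then obtain x where
      x: "\<And>i. i \<in> {1..k} \<Longrightarrow> x i \<in> B i \<and> x i ^ M ((\<sigma> ^^ n) i) = v ((\<sigma> ^^ n) i)"
      by metis
    \<comment> \<open>Restriction makes the point extensional, as membership in the box and
      \<open>torus_map_funpow\<close> require.\<close>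
    define z where "z = restrict x {1..k}"
    have "z \<in> U" using B(3) x by (auto simp: z_def)
    have "(torus_map k \<sigma> m ^^ n) z = (\<lambda>i\<in>{1..k}. z ((inv \<sigma> ^^ n) i) ^ M i)"
      unfolding M_def by (rule torus_map_funpow[OF assms(2)]) (simp add: z_def)
    also have "\<dots> = v"
    proof (rule extensionalityI[of _ "{1..k}"])
      fix i assume i: "i \<in> {1..k}"
      have "(\<sigma> ^^ n) ((inv \<sigma> ^^ n) i) = i"
        using fn_o_inv_fn_is_id[OF bij, of n] by (simp add: fun_eq_iff)
      then show "(\<lambda>i\<in>{1..k}. z ((inv \<sigma> ^^ n) i) ^ M i) i = v i"
        using i x[OF in_inv[OF i, of n]] in_inv[OF i, of n] by (simp add: z_def)
    qed (use v in \<open>auto simp: PiE_def\<close>)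
    finally show ?thesis using \<open>z \<in> U\<close> by blast
  qed
  then show "\<exists>N. \<forall>n>N. (torus_map k \<sigma> m ^^ n) ` U \<inter> V \<noteq> {}"
    using \<open>v \<in> V\<close> by blast
qed

end
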